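(* Let $\lambda=\langle0^{m_0},1^{m_1},\dots,s^{m_s}\rangle$ be a partition with $n=\sum_{r=0}^s m_r$ parts and $m_0\ge1$, let $x_1,\dots,x_n>0$, and set $M_r=m_r+\cdots+m_s$ for $1\le r\le s$ and $M_{s+1}=0$. For $1\le j\le s$ with $m_j\ge1$, the density of the particle of species $j$ at the first site in the multispecies PushTASEP with content $\lambda$ is given by $$\langle\eta^{(j)}_1\rangle=x_1\,\frac{s_{\langle1^{m_j-1},\,2^{M_{j+1}}\rangle}(x_2,\dots,x_n)}{e_{(M_j,\,M_{j+1})}(x_1,\dots,x_n)}.$$
   Context: **Content and configurations.** $\langle 0^{m_0},1^{m_1},\dots,s^{m_s}\rangle$ denotes the partition of length $n$ with exactly $m_r$ parts equal to $r$. $\Omega_\lambda$ is the set of all distinct rearrangements $\eta=(\eta_1,\dots,\eta_n)$ of $\lambda$. **Multispecies PushTASEP.** The sites $1,2,\dots,n$ are arranged clockwise on a ring (site $n$ is followed by site $1$). $\eta_j=r\ge1$ means that site $j$ holds a particle of species $r$; $\eta_j=0$ means that site $j$ is vacant. The process is the continuous-time Markov chain on $\Omega_\lambda$ in which a bell rings at each site $j$ independently at rate $1/x_j$. If site $j$ is vacant when its bell rings, nothing changes. Otherwise let $i_1=\eta_j$; this particle moves to the first site $j_2$ clockwise from $j$ with $i_2:=\eta_{j_2}<i_1$. If $i_2=0$ the jump is complete; otherwise the displaced particle of species $i_2$ moves to the first site $j_3$ clockwise from $j_2$ with $\eta_{j_3}<i_2$, and so on until a vacancy is filled. All these moves occur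 instantaneously and site $j$ is left vacant. The chain is irreducible; $\langle\cdot\rangle$ denotes expectation in its stationary distribution. $\eta^{(j)}_k$ is the indicator that site $k$ is occupied by a particle of species $j$. **Symmetric functions.** $e_m(x_1,\dots,x_n)=\sum_{1\le i_1<\cdots<i_m\le n}x_{i_1}\cdots x_{i_m}$, $e_0=1$, $e_{(a,b)}=e_ae_b$. $s_\mu$ is the Schur polynomial, and $\langle1^b,2^a\rangle$ is the partition with $a$ parts equal to $2$ and $b$ parts equal to $1$. *)

theory Defs
  imports "HOL-Probability.Probability"
begin

section \<open>Symmetric polynomials evaluated at real points\<close>

text \<open>The variables are the \<open>x i\<close> with \<open>i\<close> ranging over a finite index set \<open>I\<close>.\<close>

definition elem_sym :: "nat set \<Rightarrow> (nat \<Rightarrow> real) \<Rightarrow> nat \<Rightarrow> real" where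
  "elem_sym I x k = (\<Sum>A | A \<subseteq> I \<and> card A = k. \<Prod>i\<in>A. x i)"

text \<open>Partitions are weakly decreasing lists of parts; row and column indices start at 0.\<close>

definition young_diagram :: "nat list \<Rightarrow> (nat \<times> nat) set" where
  "young_diagram \<mu> = {(r, c). r < length \<mu> \<and> c < \<mu> ! r}"

definition ssyt :: "nat set \<Rightarrow> nat list \<Rightarrow> (nat \<times> nat \<Rightarrow> nat) set" where
  "ssyt I \<mu> = {T \<in> young_diagram \<mu> \<rightarrow>\<^sub>E I.
     (\<forall>r c. (r, Suc c) \<in> young_diagram \<mu> \<longrightarrow> T (r, c) \<le> T (r, Suc c)) \<and>
     (\<forall>r c. (Suc r, c) \<in> young_diagram \<mu> \<longrightarrow> T (r, c) < T (Suc r, c))}"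

definition schur :: "nat set \<Rightarrow> (nat \<Rightarrow> real) \<Rightarrow> nat list \<Rightarrow> real" where
  "schur I x \<mu> = (\<Sum>T\<in>ssyt I \<mu>. \<Prod>b\<in>young_diagram \<mu>. x (T b))"

section \<open>The multispecies PushTASEP\<close>

text \<open>A configuration assigns to each site in \<open>{1..n}\<close> the species of its particle, 0 meaning vacant.
  Species \<open>r\<close> occurs \<open>m r\<close> times, so for \<open>n = m 0 + \<dots> + m s\<close> these are exactly the distinct
  rearrangements of the partition with content \<open>m\<close>.\<close>

definition configs :: "nat \<Rightarrow> nat \<Rightarrow> (nat \<Rightarrow> nat) \<Rightarrow> (nat \<Rightarrow> nat) set" where
  "configs n s m = {\<eta> \<in> {1..n} \<rightarrow>\<^sub>E {0..s}. \<forall>r\<in>{0..s}. card {k \<in> {1..n}. \<eta> k = r} = m r}"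

text \<open>The site reached from site \<open>j\<close> by \<open>d\<close> clockwise steps on the ring \<open>1, 2, \<dots>, n, 1, \<dots>\<close>:\<close>

definition clockwise :: "nat \<Rightarrow> nat \<Rightarrow> nat \<Rightarrow> nat" where
  "clockwise n j d = (j + d - 1) mod n + 1"

definition first_lower :: "nat \<Rightarrow> (nat \<Rightarrow> nat) \<Rightarrow> nat \<Rightarrow> nat \<Rightarrow> nat" where
  "first_lower n \<eta> j i = clockwise n j (LEAST d. 1 \<le> d \<and> \<eta> (clockwise n j d) < i)"

text \<open>\<open>settle n \<eta> j i\<close>: a particle of species \<open>i\<close> has just left site \<open>j\<close> and moves to the first site
  holding something lower, whose occupant is displaced in turn; displacing ``species 0'' means that
  a vacancy has been filled. The guard only serves termination: as the site whose bell rang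
  is emptied first, a lower site always exists. If there is another vacancy (\<open>m 0 \<ge> 1\<close>), it is
  filled before the emptied site is ever reached, so the latter is left vacant.\<close>

function settle :: "nat \<Rightarrow> (nat \<Rightarrow> nat) \<Rightarrow> nat \<Rightarrow> nat \<Rightarrow> (nat \<Rightarrow> nat)" where
  "settle n \<eta> j i =
     (if i = 0 then \<eta>
      else if \<eta> (first_lower n \<eta> j i) < i
        then settle n (\<eta>(first_lower n \<eta> j i := i)) (first_lower n \<eta> j i)
               (\<eta> (first_lower n \<eta> j i))
        else \<eta>)"
  by pat_completeness auto
termination by (relation "Wellfounded.measure (\<lambda>(n, \<eta>, j, i). i)") auto

declare settle.simps [simp del]

definition ring_bell :: "nat \<Rightarrow> (nat \<Rightarrow> nat) \<Rightarrow> nat \<Rightarrow> (nat \<Rightarrow> nat)" where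
  "ring_bell n \<eta> j = (if \<eta> j = 0 then \<eta> else settle n (\<eta>(j := 0)) j (\<eta> j))"

definition jump_rate :: "nat \<Rightarrow> (nat \<Rightarrow> real) \<Rightarrow> (nat \<Rightarrow> nat) \<Rightarrow> (nat \<Rightarrow> nat) \<Rightarrow> real" where
  "jump_rate n x \<eta> \<zeta> = (\<Sum>j | j \<in> {1..n} \<and> ring_bell n \<eta> j = \<zeta>. 1 / x j)"

text \<open>Stationarity of a law for the finite-state continuous-time chain, as global balance: the
  probability flux into every state equals the flux out of it.\<close>

definition pushtasep_stationary ::
    "nat \<Rightarrow> nat \<Rightarrow> (nat \<Rightarrow> nat) \<Rightarrow> (nat \<Rightarrow> real) \<Rightarrow> (nat \<Rightarrow> nat) pmf \<Rightarrow> bool" where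
  "pushtasep_stationary n s m x \<pi> \<longleftrightarrow>
     set_pmf \<pi> \<subseteq> configs n s m \<and>
     (\<forall>\<zeta>\<in>configs n s m.
        (\<Sum>\<eta>\<in>configs n s m - {\<zeta>}. pmf \<pi> \<eta> * jump_rate n x \<eta> \<zeta>) =
        pmf \<pi> \<zeta> * (\<Sum>\<eta>\<in>configs n s m - {\<zeta>}. jump_rate n x \<zeta> \<eta>))"

definition occupied :: "nat \<Rightarrow> nat \<Rightarrow> (nat \<Rightarrow> nat) \<Rightarrow> real" where
  "occupied r k \<eta> = (if \<eta> k = r then 1 else 0)"

definition tail_count :: "nat \<Rightarrow> (nat \<Rightarrow> nat) \<Rightarrow> nat \<Rightarrow> nat" where
  "tail_count s m r = (\<Sum>k=r..s. m k)"

end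

theory Submission
  imports Defs
begin

text \<open>The sites holding species at least \<open>r\<close> evolve as a single-species PushTASEP, so the density of
  species \<open>j\<close> is a difference of two single-species densities. For a single species, sending a
  configuration \<open>A\<close> and a bell \<open>j \<in> A\<close> to the new configuration and the site that was filled is
  injective and turns the flux \<open>(\<Prod>i\<in>A. x i) / x j\<close> into the same expression for the image, so
  \<open>\<Prod>i\<in>A. x i\<close> is a stationary weight; a maximum principle for the ratio of a stationary law to
  this weight shows that there is no other one. The resulting difference is a two-by-two dual
  Jacobi--Trudi determinant, which is matched with two-column tableaux by removing the largest
  variable.\<close>

section \<open>Two-column Schur polynomials\<close>

text \<open>Extending by zero to negative indices lets the recursion in the variables and the
  two-by-two determinant hold when a column is empty, with no case distinction.\<close>

definition elem_sym_int :: "nat set \<Rightarrow> (nat \<Rightarrow> real) \<Rightarrow> int \<Rightarrow> real" where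
  "elem_sym_int I x k = (if k < 0 then 0 else elem_sym I x (nat k))"

lemma elem_sym_int_of_nat [simp]: "elem_sym_int I x (int k) = elem_sym I x k"
  by (simp add: elem_sym_int_def)

lemma elem_sym_0: "finite I \<Longrightarrow> elem_sym I x 0 = 1"
proof -
  assume "finite I"
  then have "{A. A \<subseteq> I \<and> card A = 0} = {{}}"
    by (auto dest: finite_subset)
  then show ?thesis by (simp add: elem_sym_def)
qed

lemma elem_sym_pos:
  assumes "finite I" "\<And>i. i \<in> I \<Longrightarrow> 0 < x i" "k \<le> card I"
  shows "0 < elem_sym I x k"
proof -
  obtain A where "A \<subseteq> I" "card A = k"
    using assms(3) obtain_subset_with_card_n by metis
  then show ?thesis
    unfolding elem_sym_def using assms(1,2) finite_subset[of _ "Pow I"]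
    by (intro sum_pos prod_pos) (auto simp: subset_iff)
qed

lemma elem_sym_insert:
  assumes "finite I" "t \<notin> I"
  shows "elem_sym (insert t I) x (Suc k) = elem_sym I x (Suc k) + x t * elem_sym I x k"
proof -
  let ?P = "\<lambda>k. {A. A \<subseteq> I \<and> card A = k}"
  have fin: "finite (?P k)" for k
    using assms(1) by simp
  have split: "{A. A \<subseteq> insert t I \<and> card A = Suc k} = ?P (Suc k) \<union> insert t ` ?P k"
  proof (intro equalityI subsetI)
    fix A assume A: "A \<in> {A. A \<subseteq> insert t I \<and> card A = Suc k}"
    then have "finite A"
      using assms(1) by (auto dest: finite_subset)
    show "A \<in> ?P (Suc k) \<union> insert t ` ?P k"
    proof (cases "t \<in> A")
      case True
      then have "A = insert t (A - {t})" "A - {t} \<in> ?P k"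
        using A \<open>finite A\<close> by auto
      then show ?thesis by blast
    qed (use A in auto)
  next
    fix A assume "A \<in> ?P (Suc k) \<union> insert t ` ?P k"
    then show "A \<in> {A. A \<subseteq> insert t I \<and> card A = Suc k}"
      using assms finite_subset[OF _ assms(1)] by (auto simp: card_insert_if)
  qed
  have inj: "inj_on (insert t) (?P k)"
    using assms(2) by (auto simp: inj_on_def insert_eq_iff subset_iff)
  have "(\<Sum>A\<in>insert t ` ?P k. \<Prod>i\<in>A. x i) = (\<Sum>A\<in>?P k. x t * (\<Prod>i\<in>A. x i))"
    unfolding sum.reindex[OF inj] o_def
  proof (rule sum.cong)
    fix A assume "A \<in> ?P k"
    then have "finite A" "t \<notin> A"
      using assms by (auto dest: finite_subset)
    then show "(\<Prod>i\<in>insert t A. x i) = x t * (\<Prod>i\<in>A. x i)"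
      by simp
  qed simp
  then show ?thesis
    unfolding elem_sym_def split using fin assms(2)
    by (subst sum.union_disjoint) (auto simp: sum_distrib_left)
qed

lemma elem_sym_int_insert:
  assumes "finite I" "t \<notin> I"
  shows "elem_sym_int (insert t I) x k = elem_sym_int I x k + x t * elem_sym_int I x (k - 1)"
proof (cases "k \<le> 0")
  case True
  then show ?thesis
    using assms by (auto simp: elem_sym_int_def elem_sym_0)
next
  case False
  then obtain l where "k = int (Suc l)"
    by (metis gr0_implies_Suc not_le zero_less_imp_eq_int)
  then show ?thesis
    using elem_sym_insert[OF assms, of x l] by (simp add: elem_sym_int_def nat_add_distrib)
qed

section \<open>Branching of column pairs and the dual Jacobi-Trudi identity\<close>

text \<open>Two-column tableaux as pairs of strictly increasing columns. Integer column lengths make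
  the branching rule below hold without side conditions.\<close>

definition column_pairs :: "nat set \<Rightarrow> int \<Rightarrow> int \<Rightarrow> (nat list \<times> nat list) set" where
  "column_pairs I a b = {(xs, ys). set xs \<subseteq> I \<and> set ys \<subseteq> I \<and> sorted_wrt (<) xs \<and>
     sorted_wrt (<) ys \<and> int (length xs) = a \<and> int (length ys) = b \<and>
     length ys \<le> length xs \<and> (\<forall>i<length ys. xs ! i \<le> ys ! i)}"

definition column_sum :: "nat set \<Rightarrow> (nat \<Rightarrow> real) \<Rightarrow> int \<Rightarrow> int \<Rightarrow> real" where
  "column_sum I x a b =
     (\<Sum>(xs, ys)\<in>column_pairs I a b. prod_list (map x xs) * prod_list (map x ys))"

lemma finite_column_pairs: "finite I \<Longrightarrow> finite (column_pairs I a b)"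
proof -
  assume "finite I"
  then have "finite ({xs. set xs \<subseteq> I \<and> length xs = nat a} \<times> {ys. set ys \<subseteq> I \<and> length ys = nat b})"
    by (intro finite_cartesian_product finite_lists_length_eq)
  then show ?thesis
    by (rule finite_subset[rotated]) (auto simp: column_pairs_def)
qed

text \<open>As \<open>t\<close> exceeds all of \<open>I\<close>, a strictly increasing list can
  contain it only as its last entry.\<close>

lemma strict_list_insert_max:
  assumes "set zs \<subseteq> insert t I" "sorted_wrt (<) zs" "\<forall>i\<in>I. i < (t::nat)"
  shows "set zs \<subseteq> I \<or> (\<exists>us. zs = us @ [t] \<and> set us \<subseteq> I)"
proof (cases zs rule: rev_cases)
  case (snoc us z)
  have lt: "\<forall>u\<in>set us. u < z"
    using assms(2) snoc by (simp add: sorted_wrt_append)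
  have "z \<le> t"
    using assms(1,3) snoc by fastforce
  then have "set us \<subseteq> I"
    using lt assms(1) snoc by fastforce
  then show ?thesis
    using assms(1) snoc by auto
qed simp

text \<open>The largest entry \<open>t\<close> can only sit at the bottom of a column, which gives
  four cases. The guard \<open>b \<le> a\<close> matters at \<open>b = a + 1\<close>: there the
  pairs with columns \<open>a\<close> and \<open>b - 1\<close> exist, but a further box would make
  the second column too long.\<close>

lemma column_pairs_insert_max:
  assumes "\<forall>i\<in>I. i < t"
  shows "column_pairs (insert t I) a b = column_pairs I a b
     \<union> (\<lambda>(xs, ys). (xs @ [t], ys)) ` column_pairs I (a - 1) b
     \<union> (\<lambda>(xs, ys). (xs, ys @ [t])) ` (if b \<le> a then column_pairs I a (b - 1) else {})
     \<union> (\<lambda>(xs, ys). (xs @ [t], ys @ [t])) ` column_pairs I (a - 1) (b - 1)"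
    (is "?L = ?R")
proof (intro equalityI subsetI)
  fix z assume "z \<in> ?L"
  then obtain xs ys where z: "z = (xs, ys)"
    and s: "set xs \<subseteq> insert t I" "set ys \<subseteq> insert t I" "sorted_wrt (<) xs" "sorted_wrt (<) ys"
    and len: "int (length xs) = a" "int (length ys) = b" "length ys \<le> length xs"
    and le: "\<And>i. i < length ys \<Longrightarrow> xs ! i \<le> ys ! i"
    by (auto simp: column_pairs_def)
  consider (1) "set xs \<subseteq> I" "set ys \<subseteq> I"
    | (2) us where "xs = us @ [t]" "set us \<subseteq> I" "set ys \<subseteq> I"
    | (3) vs where "set xs \<subseteq> I" "ys = vs @ [t]" "set vs \<subseteq> I"
    | (4) us vs where "xs = us @ [t]" "set us \<subseteq> I" "ys = vs @ [t]" "set vs \<subseteq> I"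
    using strict_list_insert_max[OF s(1,3) assms] strict_list_insert_max[OF s(2,4) assms] by blast
  then show "z \<in> ?R"
  proof cases
    case 1
    then show ?thesis
      using s len le z by (auto simp: column_pairs_def)
  next
    case 2
    \<comment> \<open>Otherwise \<open>t\<close> would have a right neighbour in its row, and that
      neighbour lies in \<open>I\<close>, hence below \<open>t\<close>.\<close>
    have "length ys \<le> length us"
    proof (rule ccontr)
      assume "\<not> ?thesis"
      then have l: "length us < length ys" by simp
      then have "t \<le> ys ! length us"
        using le[of "length us"] 2 by (simp add: nth_append)
      moreover have "ys ! length us < t"
        using l 2(3) assms nth_mem by blast
      ultimately show False by simp
    qed
    moreover have "us ! i \<le> ys ! i" if "i < length ys" for i
      using le[OF that] that 2 calculation by (simp add: nth_append)
    ultimately have "(us, ys) \<in> column_pairs I (a - 1) b"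
      using 2 s len by (auto simp: column_pairs_def sorted_wrt_append)
    then show ?thesis
      using 2 z by force
  next
    case 3
    have "xs ! i \<le> vs ! i" if "i < length vs" for i
      using le[of i] that 3 by (simp add: nth_append)
    then have "(xs, vs) \<in> column_pairs I a (b - 1)"
      using 3 s len by (auto simp: column_pairs_def sorted_wrt_append)
    then show ?thesis
      using 3 z len by force
  next
    case 4
    have "us ! i \<le> vs ! i" if "i < length vs" for i
      using le[of i] that 4 len by (simp add: nth_append)
    then have "(us, vs) \<in> column_pairs I (a - 1) (b - 1)"
      using 4 s len by (auto simp: column_pairs_def sorted_wrt_append)
    then show ?thesis
      using 4 z by force
  qed
next
  fix z assume "z \<in> ?R"
  then consider (1) "z \<in> column_pairs I a b"
    | (2) us ys where "z = (us @ [t], ys)" "(us, ys) \<in> column_pairs I (a - 1) b"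
    | (3) xs vs where "b \<le> a" "z = (xs, vs @ [t])" "(xs, vs) \<in> column_pairs I a (b - 1)"
    | (4) us vs where "z = (us @ [t], vs @ [t])" "(us, vs) \<in> column_pairs I (a - 1) (b - 1)"
    by (auto split: if_splits)
  then show "z \<in> ?L"
  proof cases
    case 1
    then show ?thesis
      by (auto simp: column_pairs_def)
  next
    case 2
    then show ?thesis
      using assms by (auto simp: column_pairs_def sorted_wrt_append nth_append)
  next
    case 3
    then have "length vs < length xs" "set xs \<subseteq> I"
      by (auto simp: column_pairs_def)
    then have "xs ! length vs \<le> t"
      using assms nth_mem by (meson less_imp_le subset_iff)
    then show ?thesis
      using 3 assms by (auto simp: column_pairs_def sorted_wrt_append nth_append less_Suc_eq)
  next
    case 4
    then have "set us \<subseteq> I" by (simp add: column_pairs_def)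
    then have "us ! length vs \<le> t" if "length vs < length us"
      using assms that nth_mem by (meson less_imp_le subset_iff)
    then show ?thesis
      using 4 assms by (auto simp: column_pairs_def sorted_wrt_append nth_append less_Suc_eq)
  qed
qed

lemma column_sum_insert_max:
  assumes "finite I" "\<forall>i\<in>I. i < t" "b \<le> a"
  shows "column_sum (insert t I) x a b = column_sum I x a b + x t * column_sum I x (a - 1) b
    + x t * column_sum I x a (b - 1) + x t * x t * column_sum I x (a - 1) (b - 1)"
proof -
  let ?f = "\<lambda>(xs, ys). prod_list (map x xs) * prod_list (map x ys) :: real"
  have mem: "set xs \<subseteq> I" "set ys \<subseteq> I" if "(xs, ys) \<in> column_pairs I a' b'" for xs ys a' b'
    using that by (auto simp: column_pairs_def)
  have t: "t \<notin> I"
    using assms(2) by blast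
  note fin = finite_column_pairs[OF assms(1)]
  let ?g1 = "\<lambda>(xs, ys). (xs @ [t], ys)" and ?g2 = "\<lambda>(xs, ys). (xs, ys @ [t])"
    and ?g3 = "\<lambda>(xs, ys). (xs @ [t], ys @ [t])"
  have i: "inj_on ?g1 X" "inj_on ?g2 X" "inj_on ?g3 X" for X
    by (auto simp: inj_on_def)
  have "column_sum (insert t I) x a b = sum ?f (column_pairs I a b)
     + sum ?f (?g1 ` column_pairs I (a - 1) b)
     + sum ?f (?g2 ` column_pairs I a (b - 1))
     + sum ?f (?g3 ` column_pairs I (a - 1) (b - 1))"
    unfolding column_sum_def column_pairs_insert_max[OF assms(2)] using fin t assms(3)
    by (subst sum.union_disjoint; (force dest: mem)?)+
  then show ?thesis
    unfolding sum.reindex[OF i(1)] sum.reindex[OF i(2)] sum.reindex[OF i(3)]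
    by (simp add: o_def case_prod_unfold column_sum_def sum_distrib_left algebra_simps)
qed

lemma column_sum_eq_0: "a < b \<Longrightarrow> column_sum I x a b = 0"
proof -
  assume "a < b"
  then have "column_pairs I a b = {}"
    by (auto simp: column_pairs_def)
  then show ?thesis by (simp add: column_sum_def)
qed

text \<open>Both sides obey the same branching rule when a new largest variable is added. The
  boundary \<open>b = a + 1\<close> must be included, because branching at \<open>b = a\<close>
  shortens the first column and lands exactly there.\<close>

theorem column_sum_jacobi_trudi:
  assumes "finite I" "b - 1 \<le> a"
  shows "column_sum I x a b =
    elem_sym_int I x a * elem_sym_int I x b - elem_sym_int I x (a + 1) * elem_sym_int I x (b - 1)"
  using assms
proof (induction I arbitrary: a b rule: finite_linorder_max_induct)
  case empty
  have "elem_sym {} x (Suc k) = 0" for k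
    unfolding elem_sym_def by (rule sum.neutral) simp
  then have e: "elem_sym_int {} x k = (if k = 0 then 1 else 0)" for k
    using elem_sym_0[of "{}" x] by (cases "nat k") (simp_all add: elem_sym_int_def)
  have "column_pairs {} a b = (if a = 0 \<and> b = 0 then {([], [])} else {})"
    by (auto simp: column_pairs_def)
  then show ?case
    using empty by (auto simp: column_sum_def e)
next
  case (insert t I)
  have t: "t \<notin> I" "\<forall>i\<in>I. i < t"
    using insert.hyps by auto
  show ?case
  proof (cases "b \<le> a")
    case True
    show ?thesis
      unfolding column_sum_insert_max[OF insert.hyps(1) t(2) True]
        elem_sym_int_insert[OF insert.hyps(1) t(1)]
      using True by (simp add: insert.IH algebra_simps)
  next
    case False
    \<comment> \<open>There are no pairs here, and the two products of the determinant are
      equal.\<close>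
    then have "b = a + 1"
      using insert.prems by simp
    then show ?thesis
      by (simp add: column_sum_eq_0)
  qed
qed

section \<open>Comparison with semistandard tableaux\<close>

lemma young_diagram_two_column:
  "young_diagram (replicate b 2 @ replicate c 1) = (\<lambda>r. (r, 0)) ` {..<b + c} \<union> (\<lambda>r. (r, 1)) ` {..<b}"
  by (auto simp: young_diagram_def nth_append less_Suc_eq numeral_2_eq_2 split: if_splits)

text \<open>Reading the two columns of a tableau downwards is a weight-preserving bijection: strict
  columns become sorted lists, weak rows become the entrywise comparison.\<close>

lemma schur_two_column:
  assumes "finite I"
  shows "schur I x (replicate b 2 @ replicate c 1) = column_sum I x (int (b + c)) (int b)"
proof -
  let ?\<mu> = "replicate b 2 @ replicate c (1::nat)"
  define Y where "Y = young_diagram ?\<mu>"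
  have Y: "Y = (\<lambda>r. (r, 0)) ` {..<b + c} \<union> (\<lambda>r. (r, 1)) ` {..<b}"
    unfolding Y_def by (rule young_diagram_two_column)
  have memY: "(r, k) \<in> Y \<longleftrightarrow> k = 0 \<and> r < b + c \<or> k = 1 \<and> r < b" for r k
    unfolding Y by auto
  define cols where "cols T = (map (\<lambda>r. T (r, 0)) [0..<b + c], map (\<lambda>r. T (r, 1)) [0..<b])"
    for T :: "nat \<times> nat \<Rightarrow> nat"
  \<comment> \<open>Tableaux are extensional functions, so the inverse map has to be restricted to
    the diagram.\<close>
  define fill where "fill = (\<lambda>(xs, ys :: nat list). \<lambda>p\<in>Y. (if snd p = 0 then xs else ys) ! fst p)"
  show ?thesis
    unfolding schur_def column_sum_def Y_def[symmetric]
  proof (rule sum.reindex_bij_witness[where i = fill and j = cols])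
    fix T assume T: "T \<in> ssyt I ?\<mu>"
    then have ext: "T \<in> extensional Y" and TI: "\<And>p. p \<in> Y \<Longrightarrow> T p \<in> I"
      and row: "\<And>r. r < b \<Longrightarrow> T (r, 0) \<le> T (r, 1)"
      and col: "\<And>r k. (Suc r, k) \<in> Y \<Longrightarrow> T (r, k) < T (Suc r, k)"
    proof -
      show "T \<in> extensional Y" "\<And>p. p \<in> Y \<Longrightarrow> T p \<in> I"
        "\<And>r k. (Suc r, k) \<in> Y \<Longrightarrow> T (r, k) < T (Suc r, k)"
        using T by (auto simp: ssyt_def PiE_def Y_def)
      show "T (r, 0) \<le> T (r, 1)" if "r < b" for r
        using T that memY[of r 1] by (simp add: ssyt_def Y_def)
    qed
    show "fill (cols T) = T"
      by (rule extensionalityI[OF _ ext])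
        (auto simp: fill_def cols_def memY)
    \<comment> \<open>\<open>col\<close> compares only neighbouring rows; induction down the column
      extends it to any two rows.\<close>
    have "sorted_wrt (<) (map (\<lambda>r. T (r, k)) [0..<l])" if "\<And>r. r < l \<Longrightarrow> (r, k) \<in> Y" for k l
      unfolding sorted_wrt_map
    proof (rule sorted_wrt_mono_rel[OF _ sorted_wrt_upt])
      fix r r' assume *: "r \<in> set [0..<l]" "r' \<in> set [0..<l]" "r < r'"
      then have "(r', k) \<in> Y" using that by auto
      with \<open>r < r'\<close> show "T (r, k) < T (r', k)"
      proof (induction r')
        case (Suc l)
        have "T (l, k) < T (Suc l, k)" "(l, k) \<in> Y"
          using col Suc.prems by (auto simp: memY)
        then show ?case
          using Suc by (cases "r = l") auto
      qed simp
    qed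
    then show "cols T \<in> column_pairs I (int (b + c)) (int b)"
      using TI row by (auto simp: column_pairs_def cols_def memY)
    show "(case cols T of (xs, ys) \<Rightarrow> prod_list (map x xs) * prod_list (map x ys)) =
        (\<Prod>p\<in>Y. x (T p))"
    proof -
      have col: "prod_list (map x (map (\<lambda>r. T (r, k)) [0..<l])) =
          (\<Prod>p\<in>(\<lambda>r. (r, k)) ` {..<l}. x (T p))" for k l
      proof -
        have "prod_list (map (\<lambda>r. x (T (r, k))) [0..<l]) = (\<Prod>r<l. x (T (r, k)))"
          by (subst prod.distinct_set_conv_list[symmetric]) (simp_all add: atLeast0LessThan)
        moreover have "inj_on (\<lambda>r. (r, k)) {..<l}"
          by (simp add: inj_on_def)
        ultimately show ?thesis
          by (simp add: prod.reindex o_def)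
      qed
      show ?thesis
        unfolding Y cols_def prod.case col
        by (rule prod.union_disjoint[symmetric]) auto
    qed
  next
    fix p assume "p \<in> column_pairs I (int (b + c)) (int b)"
    moreover obtain xs ys where p: "p = (xs, ys)"
      by (cases p)
    ultimately have *: "set xs \<subseteq> I" "set ys \<subseteq> I" "sorted_wrt (<) xs" "sorted_wrt (<) ys"
        "length xs = b + c" "length ys = b" "\<And>i. i < b \<Longrightarrow> xs ! i \<le> ys ! i"
      unfolding column_pairs_def of_nat_eq_iff by simp_all
    show "cols (fill p) = p"
      unfolding p using *(5,6) by (auto simp: cols_def fill_def memY intro!: nth_equalityI)
    have lt: "xs ! r < xs ! Suc r" if "Suc r < b + c" for r
      using *(3,5) that by (simp add: sorted_wrt_nth_less)
    have lt': "ys ! r < ys ! Suc r" if "Suc r < b" for r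
      using *(4,6) that by (simp add: sorted_wrt_nth_less)
    have mem: "r < b + c \<Longrightarrow> xs ! r \<in> I" "r < b \<Longrightarrow> ys ! r \<in> I" for r
      using *(1,2,5,6) by (auto intro!: subsetD[OF _ nth_mem])
    show "fill p \<in> ssyt I ?\<mu>"
      unfolding p ssyt_def Y_def[symmetric] using *(7) lt lt' mem by (auto simp: fill_def memY)
  qed
qed

section \<open>Projection to a single species\<close>

lemma clockwise_in: "0 < n \<Longrightarrow> clockwise n j d \<in> {1..n}"
  by (simp add: clockwise_def Suc_leI)

lemma clockwise_add:
  assumes "1 \<le> j"
  shows "clockwise n (clockwise n j d) e = clockwise n j (d + e)"
proof -
  have "clockwise n (clockwise n j d) e = ((j + d - 1) mod n + e) mod n + 1"
    by (simp add: clockwise_def)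
  also have "\<dots> = (j + d - 1 + e) mod n + 1"
    by (simp add: mod_add_left_eq)
  also have "j + d - 1 + e = j + (d + e) - 1"
    using assms by simp
  finally show ?thesis
    by (simp add: clockwise_def)
qed

lemma clockwise_inj_left:
  assumes "j \<in> {1..n}" "k \<in> {1..n}" "clockwise n j d = clockwise n k d"
  shows "j = k"
proof -
  have "(j - 1 + d) mod n = (k - 1 + d) mod n"
    using assms by (simp add: clockwise_def)
  then have "(j - 1) mod n = (k - 1) mod n"
    using nat_mod_eq_iff by auto
  then show ?thesis
    using assms by auto
qed

lemma clockwise_neq:
  assumes "j \<in> {1..n}" "0 < d" "d < n"
  shows "clockwise n j d \<noteq> j"
proof
  assume "clockwise n j d = j"
  then have "(j - 1 + d) mod n = j - 1"
    using assms(1) by (simp add: clockwise_def)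
  then show False
    using assms by (cases "j - 1 + d < n") (auto simp: le_mod_geq)
qed

text \<open>Distances run from 1 to \<open>n\<close>, not from 0: a search starts one step ahead and
  sees its own starting site only after a full turn.\<close>

lemma clockwise_reach:
  assumes "j \<in> {1..n}" "k \<in> {1..n}"
  obtains d where "1 \<le> d" "d \<le> n" "clockwise n j d = k"
proof (cases "j < k")
  case True
  then show thesis
    using assms by (intro that[of "k - j"]) (auto simp: clockwise_def)
next
  case False
  have "clockwise n j (n + k - j) = k"
    using assms False by (auto simp: clockwise_def mod_if)
  then show thesis
    using assms False by (intro that[of "n + k - j"]) auto
qed

text \<open>Abstracts \<open>first_lower\<close> to an arbitrary predicate, so that searches with
  different thresholds can be compared and the single-species jump is expressed by the same
  function.\<close>

definition next_site :: "nat \<Rightarrow> (nat \<Rightarrow> bool) \<Rightarrow> nat \<Rightarrow> nat" where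
  "next_site n P j = clockwise n j (LEAST d. 1 \<le> d \<and> P (clockwise n j d))"

lemma first_lower_next_site: "first_lower n \<eta> j i = next_site n (\<lambda>k. \<eta> k < i) j"
  by (simp add: first_lower_def next_site_def)

text \<open>A witness \<open>k\<close> stops the search within one turn; a witness other than
  \<open>j\<close> stops it strictly before the turn is complete.\<close>

lemma next_site_eq_clockwise:
  assumes "j \<in> {1..n}" "k \<in> {1..n}" "P k"
  shows "\<exists>d. 1 \<le> d \<and> d \<le> n \<and> (k \<noteq> j \<longrightarrow> d < n) \<and> next_site n P j = clockwise n j d \<and>
    P (clockwise n j d) \<and> (\<forall>e. 1 \<le> e \<and> e < d \<longrightarrow> \<not> P (clockwise n j e))"
proof -
  let ?Q = "\<lambda>d. 1 \<le> d \<and> P (clockwise n j d)"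
  define d where "d = Least ?Q"
  obtain e where e: "1 \<le> e" "e \<le> n" "clockwise n j e = k"
    using clockwise_reach[OF assms(1,2)] .
  then have Q: "?Q e" using assms(3) by simp
  have "d \<le> e"
    unfolding d_def using Q by (rule Least_le)
  have "?Q d"
    unfolding d_def using Q by (rule LeastI)
  have "\<not> ?Q e" if "e < d" for e
    using that unfolding d_def by (rule not_less_Least)
  moreover have "clockwise n j n = j"
    using assms(1) by (auto simp: clockwise_def mod_if)
  then have "e \<noteq> n" if "k \<noteq> j"
    using e that by metis
  moreover have "next_site n P j = clockwise n j d"
    by (simp add: next_site_def d_def)
  ultimately show ?thesis
    using \<open>d \<le> e\<close> \<open>?Q d\<close> e(2) by (intro exI[of _ d]) auto
qed

lemma next_site_sat:
  assumes "j \<in> {1..n}" "k \<in> {1..n}" "P k"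
  shows "P (next_site n P j)"
  using next_site_eq_clockwise[of j n k P, OF assms] by auto

lemma next_site_eqI:
  assumes "1 \<le> d" "P (clockwise n j d)" "\<And>e. 1 \<le> e \<Longrightarrow> e < d \<Longrightarrow> \<not> P (clockwise n j e)"
  shows "next_site n P j = clockwise n j d"
proof -
  have "(LEAST d. 1 \<le> d \<and> P (clockwise n j d)) = d"
    using assms by (intro Least_equality) (auto simp: not_less[symmetric])
  then show ?thesis by (simp add: next_site_def)
qed

lemma next_site_in: "0 < n \<Longrightarrow> next_site n P j \<in> {1..n}"
  unfolding next_site_def by (rule clockwise_in)

lemma next_site_cong:
  assumes "0 < n" "\<And>k. k \<in> {1..n} \<Longrightarrow> P k = Q k"
  shows "next_site n P j = next_site n Q j"
  unfolding next_site_def using assms(2)[OF clockwise_in[OF assms(1)]] by simp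

text \<open>A search for the stronger \<open>P\<close> cannot stop before the first
  \<open>Q\<close>-site, so it stops there if that site satisfies \<open>P\<close>.\<close>

lemma next_site_mono_same:
  assumes "j \<in> {1..n}" "k \<in> {1..n}" "Q k" "\<And>k. P k \<Longrightarrow> Q k" "P (next_site n Q j)"
  shows "next_site n P j = next_site n Q j"
proof -
  obtain d where "1 \<le> d" "next_site n Q j = clockwise n j d"
    "\<And>e. 1 \<le> e \<Longrightarrow> e < d \<Longrightarrow> \<not> Q (clockwise n j e)"
    using next_site_eq_clockwise[of j n k Q, OF assms(1-3)] by auto
  then show ?thesis
    using assms(4,5) next_site_eqI[of d P n j] by auto
qed

text \<open>No \<open>P\<close>-site is passed on the way to the first \<open>Q\<close>-site, so a
  search for \<open>P\<close> may be interrupted there and resumed.\<close>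

lemma next_site_mono_trans:
  assumes "j \<in> {1..n}" "k \<in> {1..n}" "P k" "\<And>k. P k \<Longrightarrow> Q k" "\<not> P (next_site n Q j)"
  shows "next_site n P (next_site n Q j) = next_site n P j"
proof -
  obtain d where d: "1 \<le> d" "next_site n Q j = clockwise n j d"
    "\<And>e. 1 \<le> e \<Longrightarrow> e < d \<Longrightarrow> \<not> Q (clockwise n j e)"
    using next_site_eq_clockwise[of j n k Q, OF assms(1,2) assms(4)[OF assms(3)]] by auto
  obtain c where c: "1 \<le> c" "next_site n P j = clockwise n j c" "P (clockwise n j c)"
    "\<And>e. 1 \<le> e \<Longrightarrow> e < c \<Longrightarrow> \<not> P (clockwise n j e)"
    using next_site_eq_clockwise[of j n k P, OF assms(1-3)] by auto
  have "d < c"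
    using c(1,3) d assms(4,5) by (metis nat_neq_iff)
  have add: "clockwise n (clockwise n j d) e = clockwise n j (d + e)" for e
    using assms(1) by (intro clockwise_add) simp
  have "next_site n P (clockwise n j d) = clockwise n (clockwise n j d) (c - d)"
    using c \<open>d < c\<close> by (intro next_site_eqI) (auto simp: add)
  then show ?thesis
    using \<open>d < c\<close> by (simp add: add d(2) c(2))
qed

text \<open>The site filled when the bell at \<open>j\<close> rings, with \<open>j\<close> itself
  counted as emptied. For a bell at a vacant site the value \<open>j\<close> is a convention: it
  keeps the map to (\<open>push\<close>, \<open>vac\<close>) injective and makes the weight identity
  trivial for such null moves.\<close>

definition vac :: "nat \<Rightarrow> nat set \<Rightarrow> nat \<Rightarrow> nat" where
  "vac n A j = (if j \<in> A then next_site n (\<lambda>k. k \<notin> A - {j}) j else j)"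

definition push :: "nat \<Rightarrow> nat set \<Rightarrow> nat \<Rightarrow> nat set" where
  "push n A j = (if j \<in> A then insert (vac n A j) (A - {j}) else A)"

lemma settle_outside: "0 < n \<Longrightarrow> k \<notin> {1..n} \<Longrightarrow> settle n \<eta> j i k = \<eta> k"
proof (induction n \<eta> j i rule: settle.induct)
  case (1 n \<eta> j i)
  have "first_lower n \<eta> j i \<noteq> k"
    using next_site_in[OF "1.prems"(1), of "\<lambda>k. \<eta> k < i" j] "1.prems"(2)
    unfolding first_lower_next_site by metis
  then show ?case
    using "1.IH" "1.prems" by (subst settle.simps) (auto simp: fun_upd_def)
qed

text \<open>While the displaced species are at least \<open>r\<close>, the superlevel set is
  unchanged, since their sites receive something larger. The first displaced species below
  \<open>r\<close> adds its site, which is the first site below \<open>r\<close> clockwise from the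
  start, as interrupted searches may be resumed. All later moves happen below
  \<open>r\<close>.\<close>

lemma superlevel_settle:
  assumes "1 \<le> r" "j \<in> {1..n}" "\<exists>k\<in>{1..n}. \<eta> k = 0"
  shows "{k \<in> {1..n}. r \<le> settle n \<eta> j i k} =
    (if r \<le> i then insert (next_site n (\<lambda>k. \<eta> k < r) j) {k \<in> {1..n}. r \<le> \<eta> k}
     else {k \<in> {1..n}. r \<le> \<eta> k})"
  using assms
proof (induction n \<eta> j i rule: settle.induct)
  case (1 n \<eta> j i)
  show ?case
  proof (cases "i = 0")
    case True
    then show ?thesis
      using "1.prems"(1) by (simp add: settle.simps)
  next
    case False
    obtain z where z: "z \<in> {1..n}" "\<eta> z = 0"
      using "1.prems"(3) by blast
    define f where "f = next_site n (\<lambda>k. \<eta> k < i) j"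
    have n: "0 < n" using z by simp
    have f: "\<eta> f < i" "f \<in> {1..n}"
      using next_site_sat[OF "1.prems"(2) z(1), of "\<lambda>k. \<eta> k < i"] z False
        next_site_in[OF n] by (auto simp: f_def)
    have step: "settle n \<eta> j i = settle n (\<eta>(f := i)) f (\<eta> f)"
      using False f(1) by (subst settle.simps) (simp add: first_lower_next_site flip: f_def)
    \<comment> \<open>Covers the step at which the cascade crosses the threshold
      \<open>r\<close>.\<close>
    have low: "next_site n (\<lambda>k. \<eta> k < r) j = f" if "r \<le> i" "\<eta> f < r"
      unfolding f_def using next_site_mono_same[OF "1.prems"(2) z(1), of "\<lambda>k. \<eta> k < i" "\<lambda>k. \<eta> k < r"]
        that z False by (auto simp flip: f_def)
    show ?thesis
    proof (cases "\<eta> f = 0")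
      case True
      have "settle n \<eta> j i = \<eta>(f := i)"
        unfolding step True by (simp add: settle.simps)
      then show ?thesis
        using low f True "1.prems"(1) by auto
    next
      case nz: False
      have "\<exists>k\<in>{1..n}. (\<eta>(f := i)) k = 0"
        using z nz by (intro bexI[of _ z]) auto
      then have IH: "{k \<in> {1..n}. r \<le> settle n (\<eta>(f := i)) f (\<eta> f) k} =
        (if r \<le> \<eta> f then insert (next_site n (\<lambda>k. (\<eta>(f := i)) k < r) f)
            {k \<in> {1..n}. r \<le> (\<eta>(f := i)) k}
         else {k \<in> {1..n}. r \<le> (\<eta>(f := i)) k})"
        using "1.IH"[unfolded first_lower_next_site, folded f_def,
            OF False f(1) "1.prems"(1) f(2)] by blast
      show ?thesis
      proof (cases "r \<le> \<eta> f")
        case True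
        \<comment> \<open>The site \<open>f\<close> is at or above \<open>r\<close> both before and
          after the replacement, so the search for a site below \<open>r\<close> does not notice
          it.\<close>
        have "(\<lambda>k. (\<eta>(f := i)) k < r) = (\<lambda>k. \<eta> k < r)"
          using True f by auto
        moreover have "next_site n (\<lambda>k. \<eta> k < r) f = next_site n (\<lambda>k. \<eta> k < r) j"
          using next_site_mono_trans[OF "1.prems"(2) z(1), of "\<lambda>k. \<eta> k < r" "\<lambda>k. \<eta> k < i"] True f z
            "1.prems"(1) by (auto simp flip: f_def)
        moreover have "{k \<in> {1..n}. r \<le> (\<eta>(f := i)) k} = {k \<in> {1..n}. r \<le> \<eta> k}"
          using True f by auto
        ultimately show ?thesis
          using IH step True f by simp
      next
        case False
        \<comment> \<open>The rest of the cascade carries a species below \<open>r\<close>; only the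
          replacement at \<open>f\<close> counts, and it adds \<open>f\<close> exactly when
          \<open>r \<le> i\<close>.\<close>
        then show ?thesis
          unfolding step IH using f low by auto
      qed
    qed
  qed
qed

text \<open>This is lumpability: the new superlevel set depends on the old configuration only
  through its superlevel set. The emptied site \<open>j\<close> supplies the vacancy that
  \<open>superlevel_settle\<close> asks for.\<close>

lemma superlevel_ring_bell:
  assumes "1 \<le> r" "j \<in> {1..n}"
  shows "{k \<in> {1..n}. r \<le> ring_bell n \<eta> j k} = push n {k \<in> {1..n}. r \<le> \<eta> k} j"
proof (cases "\<eta> j = 0")
  case True
  then show ?thesis
    using assms by (simp add: ring_bell_def push_def)
next
  case False
  define A where "A = {k \<in> {1..n}. r \<le> \<eta> k}"
  have A: "{k \<in> {1..n}. r \<le> (\<eta>(j := 0)) k} = A - {j}"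
    using assms(1) by (auto simp: A_def)
  have v: "next_site n (\<lambda>k. (\<eta>(j := 0)) k < r) j = next_site n (\<lambda>k. k \<notin> A - {j}) j"
    using assms by (intro next_site_cong) (auto simp: A_def)
  have mem: "j \<in> A \<longleftrightarrow> r \<le> \<eta> j"
    using assms(2) by (simp add: A_def)
  have "\<exists>k\<in>{1..n}. (\<eta>(j := 0)) k = 0"
    using assms(2) by (intro bexI[of _ j]) simp_all
  then have "{k \<in> {1..n}. r \<le> ring_bell n \<eta> j k} =
      (if r \<le> \<eta> j then insert (next_site n (\<lambda>k. k \<notin> A - {j}) j) (A - {j}) else A - {j})"
    using superlevel_settle[OF assms, of "\<eta>(j := 0)" "\<eta> j", unfolded A v] False
    unfolding ring_bell_def by (simp only: if_False)
  then show ?thesis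
    unfolding A_def[symmetric] push_def vac_def mem using mem by (simp split: if_splits)
qed

section \<open>The single-species push map and its inverse\<close>

lemma vacE:
  assumes "A \<subseteq> {1..n}" "A \<noteq> {1..n}" "j \<in> A"
  obtains d where "1 \<le> d" "d < n" "vac n A j = clockwise n j d" "vac n A j \<notin> A"
    "\<And>e. 1 \<le> e \<Longrightarrow> e < d \<Longrightarrow> clockwise n j e \<in> A - {j}"
  proof -
  obtain k where k: "k \<in> {1..n}" "k \<notin> A"
    using assms(1,2) by blast
  have j: "j \<in> {1..n}" and "k \<noteq> j"
    using assms k by auto
  obtain d where d: "1 \<le> d" "d < n" "vac n A j = clockwise n j d" "clockwise n j d \<notin> A - {j}"
    "\<And>e. 1 \<le> e \<Longrightarrow> e < d \<Longrightarrow> clockwise n j e \<in> A - {j}"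
    using next_site_eq_clockwise[OF j k(1), of "\<lambda>k. k \<notin> A - {j}"] k(2) \<open>k \<noteq> j\<close> assms(3)
    unfolding vac_def by auto
  moreover have "clockwise n j d \<noteq> j"
    using clockwise_neq[OF j] d by simp
  ultimately show thesis
    by (intro that[of d]) auto
qed

lemma vac_in: "j \<in> {1..n} \<Longrightarrow> vac n A j \<in> {1..n}"
  using next_site_in[of n "\<lambda>k. k \<notin> A - {j}" j] by (cases "j \<in> A") (simp_all add: vac_def)

lemma push_subset: "A \<subseteq> {1..n} \<Longrightarrow> push n A j \<subseteq> {1..n}"
  using vac_in[of j n A] by (auto simp: push_def)

lemma card_push:
  assumes "A \<subseteq> {1..n}" "A \<noteq> {1..n}"
  shows "card (push n A j) = card A"
proof (cases "j \<in> A")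
  case True
  then have "vac n A j \<notin> A"
    by (rule vacE[OF assms])
  moreover have "finite A"
    using assms(1) finite_subset by blast
  ultimately have "card (insert (vac n A j) (A - {j})) = Suc (card (A - {j}))"
    by (intro card_insert_disjoint) auto
  also have "\<dots> = card A"
    using \<open>finite A\<close> True by (rule card_Suc_Diff1)
  finally show ?thesis
    using True by (simp only: push_def if_True)
qed (simp add: push_def)

text \<open>The site whose bell rang is recovered from the result of a push as the first vacancy
  counterclockwise from the site that was filled.\<close>

lemma inj_on_push_vac:
  "inj_on (\<lambda>(A, j). (push n A j, vac n A j)) ({A. A \<subset> {1..n}} \<times> {1..n})"
proof -
  \<comment> \<open>Null moves are recognizable from the image: the marked site is then
    vacant.\<close>
  have in_iff: "vac n A j \<in> push n A j \<longleftrightarrow> j \<in> A" for A j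
    by (auto simp: push_def vac_def)
  \<comment> \<open>If \<open>d' > d\<close>, then \<open>j\<close> is among the sites that the jump
    from \<open>j'\<close> passes over, so it is occupied afterwards; but the jump from
    \<open>j\<close> has just vacated it. By symmetry the two jump lengths agree.\<close>
  have le: "d' \<le> d" if A: "A \<subset> {1..n}" "A' \<subset> {1..n}" "j \<in> A" "j' \<in> A'"
    and eq: "push n A j = push n A' j'" "clockwise n j d = clockwise n j' d'"
    and d: "1 \<le> d" "vac n A j = clockwise n j d"
      "\<And>e. 1 \<le> e \<Longrightarrow> e < d' \<Longrightarrow> clockwise n j' e \<in> A' - {j'}"
    for A A' j j' d d'
  proof (rule ccontr)
    assume "\<not> d' \<le> d"
    have j: "j \<in> {1..n}" "j' \<in> {1..n}" and "0 < n"
      using A by auto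
    have "clockwise n (clockwise n j' (d' - d)) d = clockwise n j d"
      using \<open>\<not> d' \<le> d\<close> j by (subst clockwise_add) (auto simp: eq)
    then have "clockwise n j' (d' - d) = j"
      using clockwise_inj_left clockwise_in[OF \<open>0 < n\<close>] j by blast
    then have "j \<in> A' - {j'}"
      using d(1) d(3)[of "d' - d"] \<open>\<not> d' \<le> d\<close> by simp
    then have "j \<in> push n A j"
      unfolding eq(1) unfolding push_def using A(4) by simp
    moreover have "vac n A j \<notin> A"
      using vacE[of A n j] A by (metis psubset_eq)
    ultimately show False
      using A(3) by (auto simp: push_def)
  qed
  have *: "A = A' \<and> j = j'" if A: "A \<subset> {1..n}" "A' \<subset> {1..n}"
    and eq: "push n A j = push n A' j'" "vac n A j = vac n A' j'" for A A' j j'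
  proof (cases "j \<in> A")
    case True
    then have "j' \<in> A'"
      using in_iff eq by metis
    obtain d where d: "1 \<le> d" "vac n A j = clockwise n j d" "vac n A j \<notin> A"
      "\<And>e. 1 \<le> e \<Longrightarrow> e < d \<Longrightarrow> clockwise n j e \<in> A - {j}"
      using vacE[of A n j] A(1) True by (metis psubset_eq)
    obtain d' where d': "1 \<le> d'" "vac n A' j' = clockwise n j' d'" "vac n A' j' \<notin> A'"
      "\<And>e. 1 \<le> e \<Longrightarrow> e < d' \<Longrightarrow> clockwise n j' e \<in> A' - {j'}"
      using vacE[of A' n j'] A(2) \<open>j' \<in> A'\<close> by (metis psubset_eq)
    have cw: "clockwise n j d = clockwise n j' d'"
      using d(2) d'(2) eq(2) by simp
    have "d' \<le> d"
      by (rule le[OF A True \<open>j' \<in> A'\<close> eq(1) cw d(1,2) d'(4)])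
    moreover have "d \<le> d'"
      by (rule le[OF A(2,1) \<open>j' \<in> A'\<close> True eq(1)[symmetric] cw[symmetric] d'(1,2) d(4)])
    ultimately have "clockwise n j d = clockwise n j' d"
      using cw by simp
    moreover have "j \<in> {1..n}" "j' \<in> {1..n}"
      using A True \<open>j' \<in> A'\<close> by blast+
    ultimately have "j = j'"
      using clockwise_inj_left by blast
    moreover have "A = insert j (push n A j - {vac n A j})"
      using d(3) True by (auto simp: push_def)
    moreover have "A' = insert j' (push n A' j' - {vac n A' j'})"
      using d'(3) \<open>j' \<in> A'\<close> by (auto simp: push_def)
    ultimately show ?thesis
      using eq by simp
  next
    case False
    then have "j' \<notin> A'"
      using in_iff eq by metis
    then show ?thesis
      using False eq by (simp add: push_def vac_def)
  qed
  show ?thesis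
  proof (rule inj_onI)
    fix z z' assume "z \<in> {A. A \<subset> {1..n}} \<times> {1..n}" "z' \<in> {A. A \<subset> {1..n}} \<times> {1..n}"
      "(\<lambda>(A, j). (push n A j, vac n A j)) z = (\<lambda>(A, j). (push n A j, vac n A j)) z'"
    then show "z = z'"
      using *[of "fst z" "fst z'" "snd z" "snd z'"]
      by (simp only: case_prod_unfold prod_eq_iff mem_Times_iff mem_Collect_eq fst_conv snd_conv)
  qed
qed

text \<open>A push exchanges the factor \<open>x j\<close> for \<open>x (vac n A j)\<close>; after
  the divisions both sides are the product over \<open>A - {j}\<close>.\<close>

lemma prod_push:
  assumes "A \<subset> {1..n}" "j \<in> {1..n}" "\<And>i. i \<in> {1..n} \<Longrightarrow> 0 < (x i :: real)"
  shows "(\<Prod>i\<in>A. x i) / x j = (\<Prod>i\<in>push n A j. x i) / x (vac n A j)"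
proof (cases "j \<in> A")
  case True
  have fin: "finite A"
    using assms(1) finite_subset by blast
  have v: "vac n A j \<notin> A"
    using vacE[of A n j] assms(1) True by (metis psubset_eq)
  have "0 < x j" "0 < x (vac n A j)"
    using assms(2,3) vac_in[OF assms(2)] by blast+
  moreover have "(\<Prod>i\<in>A. x i) = x j * (\<Prod>i\<in>A - {j}. x i)"
    using fin True by (rule prod.remove)
  moreover have "(\<Prod>i\<in>push n A j. x i) = x (vac n A j) * (\<Prod>i\<in>A - {j}. x i)"
    using True v fin unfolding push_def by (simp only: if_True) (subst prod.insert; simp)
  ultimately show ?thesis
    by simp
qed (simp add: push_def vac_def)

section \<open>The stationary law\<close>

definition states :: "nat \<Rightarrow> nat \<Rightarrow> nat set set" where
  "states n M = {A. A \<subseteq> {1..n} \<and> card A = M}"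

text \<open>Null moves from \<open>B\<close> to itself are kept, so that for \<open>M < n\<close>
  every state has exactly \<open>n\<close> incoming moves.\<close>

definition moves_into :: "nat \<Rightarrow> nat \<Rightarrow> nat set \<Rightarrow> (nat set \<times> nat) set" where
  "moves_into n M B = (SIGMA A:states n M. {j \<in> {1..n}. push n A j = B})"

lemma mem_moves_into_iff:
  "z \<in> moves_into n M B \<longleftrightarrow>
    z \<in> states n M \<times> {1..n} \<and> push n (fst z) (snd z) = B"
  by (cases z) (simp add: moves_into_def conj_assoc)

lemma finite_states: "finite (states n M)"
  unfolding states_def by (rule finite_subset[of _ "Pow {1..n}"]) auto

lemma finite_moves_into: "finite (moves_into n M B)"
  unfolding moves_into_def using finite_states by (intro finite_SigmaI) auto

lemma states_psubset: "A \<in> states n M \<Longrightarrow> M < n \<Longrightarrow> A \<subset> {1..n}"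
  by (auto simp: states_def)

lemma push_in_states: "A \<in> states n M \<Longrightarrow> M < n \<Longrightarrow> push n A j \<in> states n M"
  using push_subset[of A n j] card_push[of A n j] states_psubset[of A n M]
  by (auto simp: states_def)

text \<open>The map to (\<open>push\<close>, \<open>vac\<close>) is an injective self-map of the
  finite set of states times sites, hence bijective; its fibre over \<open>B\<close> is therefore
  parametrized by the filled site.\<close>

lemma bij_betw_moves_into:
  assumes "M < n" "B \<in> states n M"
  shows "bij_betw (\<lambda>(A, j). vac n A j) (moves_into n M B) {1..n}"
proof -
  let ?f = "\<lambda>(A, j). (push n A j, vac n A j)" and ?X = "states n M \<times> {1..n}"
  have inj: "inj_on ?f ?X"
    by (rule inj_on_subset[OF inj_on_push_vac]) (use states_psubset assms(1) in auto)
  have into: "?f ` ?X \<subseteq> ?X"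
    using push_in_states[OF _ assms(1)] vac_in by fast
  have surj: "?f ` ?X = ?X"
    using finite_states by (intro endo_inj_surj inj into) auto
  show ?thesis
    unfolding bij_betw_def
  proof (intro conjI equalityI subsetI)
    show "inj_on (\<lambda>(A, j). vac n A j) (moves_into n M B)"
    proof (rule inj_onI)
      fix z z' assume z: "z \<in> moves_into n M B" "z' \<in> moves_into n M B"
        and eq: "(\<lambda>(A, j). vac n A j) z = (\<lambda>(A, j). vac n A j) z'"
      then have "?f z = ?f z'"
        by (simp add: mem_moves_into_iff case_prod_unfold)
      moreover have "z \<in> ?X" "z' \<in> ?X"
        using z by (simp_all only: mem_moves_into_iff)
      ultimately show "z = z'"
        by (rule inj_onD[OF inj])
    qed
  next
    fix k assume "k \<in> {1..n}"
    then have "(B, k) \<in> ?f ` ?X"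
      using assms(2) surj by blast
    then obtain z where z: "z \<in> ?X" "(B, k) = ?f z"
      by (rule imageE) blast
    then have "z \<in> moves_into n M B" "k = (\<lambda>(A, j). vac n A j) z"
      by (simp_all only: mem_moves_into_iff case_prod_unfold prod.inject)
    then show "k \<in> (\<lambda>(A, j). vac n A j) ` moves_into n M B"
      by (intro rev_image_eqI)
  next
    fix k assume "k \<in> (\<lambda>(A, j). vac n A j) ` moves_into n M B"
    then obtain z where "z \<in> moves_into n M B" "k = (\<lambda>(A, j). vac n A j) z"
      by (rule imageE) blast
    then show "k \<in> {1..n}"
      by (simp only: mem_moves_into_iff case_prod_unfold mem_Times_iff vac_in)
  qed
qed

section \<open>Maximum principle and uniqueness of the stationary weight\<close>

lemma initial_segmentI:
  assumes "B \<subseteq> {1..n}" "\<And>k. k \<in> B \<Longrightarrow> 2 \<le> k \<Longrightarrow> k - 1 \<in> B"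
  shows "B = {1..card B}"
proof (cases "B = {}")
  case False
  have fin: "finite B"
    using assms(1) finite_subset by blast
  have "k \<in> B" if "1 \<le> k" "k \<le> Max B" for k
    using that(2,1)
  proof (induction rule: inc_induct)
    case base
    then show ?case using fin False by simp
  next
    case (step l)
    then show ?case using assms(2)[of "Suc l"] by simp
  qed
  then have "B = {1..Max B}"
    using fin assms(1) by (auto intro: Max_ge)
  then show ?thesis
    by (metis card_atLeastAtMost diff_Suc_1)
qed simp

text \<open>Among the maximizers of \<open>u\<close>, take one with the smallest sum of positions. By harmonicity its
  predecessors are maximizers as well, so no particle beyond site 1 has a vacancy right before it.\<close>

lemma harmonic_le_initial_segment:
  fixes u :: "nat set \<Rightarrow> real"
  assumes "M < n" and pos: "\<And>i. i \<in> {1..n} \<Longrightarrow> 0 < x i"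
    and harm: "\<And>B. B \<in> states n M \<Longrightarrow>
      (\<Sum>(A, j)\<in>moves_into n M B. u A / x (vac n A j)) = u B * (\<Sum>k=1..n. 1 / x k)"
    and "B \<in> states n M"
  shows "u B \<le> u {1..M}"
proof -
  define c where "c = Max (u ` states n M)"
  have le: "u A \<le> c" if "A \<in> states n M" for A
    unfolding c_def using finite_states that by simp
  have "c \<in> u ` states n M"
    unfolding c_def using finite_states assms(4) by (intro Max_in) auto
  then obtain B1 where "B1 \<in> states n M \<and> u B1 = c"
    by blast
  from ex_has_least_nat[of "\<lambda>A. A \<in> states n M \<and> u A = c", OF this, of "\<lambda>A. \<Sum>A"]
  obtain B0 where B0: "B0 \<in> states n M" "u B0 = c"
    and least: "\<And>A. A \<in> states n M \<Longrightarrow> u A = c \<Longrightarrow> \<Sum>B0 \<le> \<Sum>A"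
    by auto
  have sub: "B0 \<subseteq> {1..n}" "card B0 = M" "finite B0"
    using B0(1) finite_subset[of B0 "{1..n}"] by (auto simp: states_def)
  have "(\<Sum>(A, j)\<in>moves_into n M B0. 1 / x (vac n A j)) = (\<Sum>k=1..n. 1 / x k)"
    using sum.reindex_bij_betw[OF bij_betw_moves_into[OF assms(1) B0(1)], of "\<lambda>k. 1 / x k"]
    by (simp add: case_prod_unfold)
  \<comment> \<open>Harmonicity at the maximizer \<open>B0\<close>: a positively weighted sum of the
    nonnegative deficits \<open>c - u A\<close> vanishes, so every deficit does.\<close>
  then have "(\<Sum>(A, j)\<in>moves_into n M B0. (c - u A) / x (vac n A j)) = 0"
    using harm[OF B0(1)] B0(2)
    by (simp add: case_prod_unfold diff_divide_distrib sum_subtractf divide_inverse[of c]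
        flip: sum_distrib_left inverse_eq_divide)
  moreover have "0 \<le> (case z of (A, j) \<Rightarrow> (c - u A) / x (vac n A j))" if "z \<in> moves_into n M B0" for z
  proof -
    obtain A j where Aj: "z = (A, j)" "A \<in> states n M" "j \<in> {1..n}"
      using \<open>z \<in> moves_into n M B0\<close> by (auto simp: moves_into_def)
    then show ?thesis
      using le[OF Aj(2)] pos[OF vac_in[OF Aj(3), of A]] by (simp add: divide_nonneg_pos)
  qed
  ultimately have zero: "(case z of (A, j) \<Rightarrow> (c - u A) / x (vac n A j)) = 0"
    if "z \<in> moves_into n M B0" for z
    using that finite_moves_into sum_nonneg_eq_0_iff[of "moves_into n M B0"] by blast
  have "k - 1 \<in> B0" if k: "k \<in> B0" "2 \<le> k" for k
  proof (rule ccontr)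
    assume nk: "k - 1 \<notin> B0"
    \<comment> \<open>\<open>A\<close> is \<open>B0\<close> with the particle at \<open>k\<close>
      moved one step back. Its bell at \<open>k - 1\<close> leads to \<open>B0\<close>, so
      \<open>A\<close> is a maximizer with a smaller sum of positions.\<close>
    define A where "A = insert (k - 1) (B0 - {k})"
    have k1: "k - 1 \<in> {1..n}"
      using k sub(1) by auto
    have A: "A \<in> states n M"
      using k nk sub k1 card_Suc_Diff1[of B0 k] by (auto simp: A_def states_def)
    have "clockwise n (k - 1) 1 = k"
      using k sub(1) by (auto simp: clockwise_def)
    then have "next_site n (\<lambda>l. l \<notin> A - {k - 1}) (k - 1) = k"
      using k(2) by (subst next_site_eqI[of 1]) (auto simp: A_def)
    then have v: "vac n A (k - 1) = k"
      by (simp add: vac_def A_def)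
    then have "push n A (k - 1) = B0"
      using k nk by (auto simp: push_def A_def)
    then have "(A, k - 1) \<in> moves_into n M B0"
      using A k1 by (simp add: moves_into_def)
    from zero[OF this] have "u A = c"
      using v k sub(1) pos[of k] by auto
    moreover have "\<Sum>A < \<Sum>B0"
      using k nk sub(3) by (simp add: A_def sum.remove[of B0 k])
    ultimately show False
      using least[OF A] by simp
  qed
  then have "B0 = {1..M}"
    using initial_segmentI[OF sub(1)] sub(2) by simp
  then show ?thesis
    using le[OF assms(4)] B0(2) by simp
qed

text \<open>Dividing by the product weight turns the balance equations into harmonicity of the ratio
  \<open>u\<close>, with rates now attached to the filled sites. The maximum principle for
  \<open>u\<close> and for \<open>- u\<close> makes \<open>u\<close> constant, and the total mass
  fixes the constant.\<close>

theorem single_species_stationary: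
  fixes p :: "nat set \<Rightarrow> real"
  assumes "M < n" and pos: "\<And>i. i \<in> {1..n} \<Longrightarrow> 0 < x i"
    and bal: "\<And>B. B \<in> states n M \<Longrightarrow>
      (\<Sum>(A, j)\<in>moves_into n M B. p A / x j) = p B * (\<Sum>k=1..n. 1 / x k)"
    and total: "(\<Sum>A\<in>states n M. p A) = 1"
    and B: "B \<in> states n M"
  shows "p B = (\<Prod>i\<in>B. x i) / elem_sym {1..n} x M"
proof -
  define w where "w A = (\<Prod>i\<in>A. x i)" for A
  define u where "u A = p A / w A" for A
  have w: "0 < w A" if "A \<in> states n M" for A
    unfolding w_def using that pos by (intro prod_pos) (auto simp: states_def)
  have harm: "(\<Sum>(A, j)\<in>moves_into n M B. u A / x (vac n A j)) = u B * (\<Sum>k=1..n. 1 / x k)"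
    if B: "B \<in> states n M" for B
  proof -
    have "p A / x j = w B * (u A / x (vac n A j))" if "(A, j) \<in> moves_into n M B" for A j
    proof -
      have *: "A \<in> states n M" "j \<in> {1..n}" "push n A j = B"
        using that by (auto simp: moves_into_def)
      have "w A / x j = w B / x (vac n A j)"
        using prod_push[OF states_psubset[OF *(1) assms(1)] *(2) pos] *(3) by (simp add: w_def)
      moreover have "p A = u A * w A"
        using w[OF *(1)] by (simp add: u_def)
      ultimately show ?thesis
        by (metis mult.commute times_divide_eq_right)
    qed
    then have "(\<Sum>(A, j)\<in>moves_into n M B. p A / x j) =
        w B * (\<Sum>(A, j)\<in>moves_into n M B. u A / x (vac n A j))"
      unfolding sum_distrib_left by (intro sum.cong) auto
    moreover have "p B = w B * u B"
      using w[OF B] by (simp add: u_def)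
    ultimately show ?thesis
      using bal[OF B] w[OF B] by (simp add: mult.assoc)
  qed
  have const: "p A = u {1..M} * w A" if "A \<in> states n M" for A
  proof -
    have "u A \<le> u {1..M}"
      by (rule harmonic_le_initial_segment[OF assms(1) pos harm that])
    moreover have "- u A \<le> - u {1..M}"
      using harm that by (intro harmonic_le_initial_segment[OF assms(1) pos])
        (simp_all add: case_prod_unfold sum_negf)
    ultimately have "u A = u {1..M}"
      by simp
    then show ?thesis
      using w[OF that] by (simp add: u_def field_simps)
  qed
  have "1 = u {1..M} * elem_sym {1..n} x M"
    using total const unfolding elem_sym_def states_def w_def by (simp add: sum_distrib_left)
  then have "u {1..M} = 1 / elem_sym {1..n} x M"
    by (metis mult_zero_right nonzero_eq_divide_eq zero_neq_one)
  then show ?thesis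
    using const[OF B] by (simp add: w_def)
qed

section \<open>Conservation of content and balance of the multispecies chain\<close>

lemma finite_configs: "finite (configs n s m)"
  unfolding configs_def by (rule finite_subset[of _ "{1..n} \<rightarrow>\<^sub>E {0..s}"]) (auto intro: finite_PiE)

lemma card_superlevel_config:
  assumes "\<eta> \<in> configs n s m"
  shows "card {k \<in> {1..n}. r \<le> \<eta> k} = tail_count s m r"
proof -
  have "{k \<in> {1..n}. r \<le> \<eta> k} = (\<Union>q\<in>{r..s}. {k \<in> {1..n}. \<eta> k = q})"
    using assms by (fastforce simp: configs_def PiE_def)
  also have "card \<dots> = (\<Sum>q=r..s. card {k \<in> {1..n}. \<eta> k = q})"
    by (rule card_UN_disjoint) auto
  also have "\<dots> = tail_count s m r"
    unfolding tail_count_def using assms by (intro sum.cong) (auto simp: configs_def)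
  finally show ?thesis .
qed

lemma card_level:
  fixes \<eta> :: "nat \<Rightarrow> nat"
  shows "card {k \<in> {1..n}. \<eta> k = q} =
    card {k \<in> {1..n}. q \<le> \<eta> k} - card {k \<in> {1..n}. Suc q \<le> \<eta> k}" (is "card ?L = card ?A - card ?B")
proof -
  have diff: "card (?A - ?B) = card ?A - card ?B"
    by (rule card_Diff_subset) auto
  have "?L = ?A - ?B"
    by auto
  from trans[OF arg_cong[where f = card, OF this] diff] show ?thesis .
qed

lemma tail_count_less:
  assumes "n = (\<Sum>r=0..s. m r)" "1 \<le> m 0" "1 \<le> r"
  shows "tail_count s m r < n"
proof -
  have "tail_count s m r \<le> (\<Sum>k=1..s. m k)"
    unfolding tail_count_def using assms(3) by (intro sum_mono2) auto
  also have "\<dots> < n"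
    using assms by (simp add: sum.atLeast_Suc_atMost)
  finally show ?thesis .
qed

lemma superlevel_in_states:
  "\<eta> \<in> configs n s m \<Longrightarrow> {k \<in> {1..n}. r \<le> \<eta> k} \<in> states n (tail_count s m r)"
  using card_superlevel_config by (auto simp: states_def)

text \<open>Pushes preserve the size of every superlevel set, and the species counts are differences
  of these sizes. That no species exceeds \<open>s\<close> is the case of the empty superlevel set
  at \<open>Suc s\<close>.\<close>

lemma ring_bell_in_configs:
  assumes n: "n = (\<Sum>r=0..s. m r)" "1 \<le> m 0" and \<eta>: "\<eta> \<in> configs n s m" and j: "j \<in> {1..n}"
  shows "ring_bell n \<eta> j \<in> configs n s m"
proof -
  let ?\<zeta> = "ring_bell n \<eta> j"
  have card: "card {k \<in> {1..n}. r \<le> ?\<zeta> k} = card {k \<in> {1..n}. r \<le> \<eta> k}" for r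
  proof (cases "r = 0")
    case False
    then have "1 \<le> r" by simp
    have "{k \<in> {1..n}. r \<le> \<eta> k} \<subset> {1..n}"
      using states_psubset[OF superlevel_in_states[OF \<eta>] tail_count_less[OF n \<open>1 \<le> r\<close>]] .
    then show ?thesis
      unfolding superlevel_ring_bell[OF \<open>1 \<le> r\<close> j] by (intro card_push) auto
  qed simp
  have "?\<zeta> k = undefined" if "k \<notin> {1..n}" for k
  proof -
    have "0 < n" "k \<noteq> j" "\<eta> k = undefined"
      using that j \<eta> by (auto simp: configs_def PiE_def extensional_def)
    then show ?thesis
      using settle_outside[OF \<open>0 < n\<close> that, of "\<eta>(j := 0)" j "\<eta> j"] by (simp add: ring_bell_def)
  qed
  moreover have "?\<zeta> k \<le> s" if "k \<in> {1..n}" for k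
  proof -
    let ?U = "{k \<in> {1..n}. Suc s \<le> ?\<zeta> k}"
    have "card ?U = 0"
      unfolding card card_superlevel_config[OF \<eta>] by (simp add: tail_count_def)
    moreover have "finite ?U"
      by simp
    ultimately have "k \<notin> ?U"
      using card_0_eq by blast
    then show ?thesis
      using that by simp
  qed
  moreover have "card {k \<in> {1..n}. ?\<zeta> k = r} = m r" if "r \<in> {0..s}" for r
  proof -
    have "card {k \<in> {1..n}. ?\<zeta> k = r} = card {k \<in> {1..n}. \<eta> k = r}"
      by (simp only: card_level card)
    then show ?thesis
      using \<eta> that by (simp add: configs_def)
  qed
  ultimately show ?thesis
    by (auto simp: configs_def PiE_def extensional_def)
qed

text \<open>Adding the rate of staying at \<open>\<zeta>\<close> to both sides makes the total
  outgoing rate the same for all states, namely the sum of all bell rates.\<close>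

lemma stationary_full_balance:
  assumes n: "n = (\<Sum>r=0..s. m r)" "1 \<le> m 0" and stat: "pushtasep_stationary n s m x \<pi>"
    and \<zeta>: "\<zeta> \<in> configs n s m"
  shows "(\<Sum>\<eta>\<in>configs n s m. pmf \<pi> \<eta> * jump_rate n x \<eta> \<zeta>) = pmf \<pi> \<zeta> * (\<Sum>k=1..n. 1 / x k)"
proof -
  let ?C = "configs n s m"
  have "(\<Sum>\<eta>\<in>?C. jump_rate n x \<zeta> \<eta>) = (\<Sum>k=1..n. 1 / x k)"
    unfolding jump_rate_def using ring_bell_in_configs[OF n \<zeta>] finite_configs
    by (intro sum.group) auto
  moreover have "(\<Sum>\<eta>\<in>?C - {\<zeta>}. pmf \<pi> \<eta> * jump_rate n x \<eta> \<zeta>) =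
      pmf \<pi> \<zeta> * (\<Sum>\<eta>\<in>?C - {\<zeta>}. jump_rate n x \<zeta> \<eta>)"
    using stat \<zeta> by (simp add: pushtasep_stationary_def)
  ultimately show ?thesis
    using sum.remove[OF finite_configs \<zeta>, of "\<lambda>\<eta>. pmf \<pi> \<eta> * jump_rate n x \<eta> \<zeta>"]
      sum.remove[OF finite_configs \<zeta>, of "jump_rate n x \<zeta>"]
    by (simp flip: distrib_left)
qed

section \<open>Density at the first site\<close>

text \<open>Obtained by subtracting the sets that avoid 1 from the full elementary symmetric
  polynomial. For \<open>M = 0\<close> the index is -1 and the right side is 0, as it should
  be.\<close>

lemma sum_with_containing_1:
  assumes "1 \<le> n"
  shows "(\<Sum>A | A \<in> states n M \<and> 1 \<in> A. \<Prod>i\<in>A. x i) = x 1 * elem_sym_int {2..n} x (int M - 1)"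
proof -
  have "(\<Sum>A | A \<in> states n M \<and> 1 \<in> A. \<Prod>i\<in>A. x i) + (\<Sum>A | A \<in> states n M \<and> 1 \<notin> A. \<Prod>i\<in>A. x i)
      = elem_sym {1..n} x M"
    unfolding elem_sym_def states_def[symmetric]
    by (subst sum.union_disjoint[symmetric])
      (auto simp: finite_states intro!: sum.cong)
  moreover have N: "{1..n} = insert 1 {2..n}"
    using assms by auto
  have "{A. A \<in> states n M \<and> 1 \<notin> A} = {A. A \<subseteq> {2..n} \<and> card A = M}"
    unfolding states_def N by (auto simp: subset_insert)
  moreover have "elem_sym_int (insert 1 {2..n}) x (int M) =
      elem_sym_int {2..n} x (int M) + x 1 * elem_sym_int {2..n} x (int M - 1)"
    by (rule elem_sym_int_insert) auto
  then have "elem_sym {1..n} x M =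
      elem_sym {2..n} x M + x 1 * elem_sym_int {2..n} x (int M - 1)"
    unfolding N[symmetric] elem_sym_int_of_nat .
  ultimately show ?thesis
    by (simp add: elem_sym_def[of "{2..n}"])
qed

text \<open>The image \<open>p\<close> of the stationary law under \<open>pr\<close> satisfies the
  single-species balance by lumpability, so it is the product law; it remains to sum over the sets
  containing 1.\<close>

lemma prob_superlevel:
  assumes n: "n = (\<Sum>r=0..s. m r)" "1 \<le> m 0" and pos: "\<And>i. i \<in> {1..n} \<Longrightarrow> 0 < x i"
    and stat: "pushtasep_stationary n s m x \<pi>" and "1 \<le> r"
  shows "(\<Sum>\<eta> | \<eta> \<in> configs n s m \<and> r \<le> \<eta> 1. pmf \<pi> \<eta>) =
    x 1 * elem_sym_int {2..n} x (int (tail_count s m r) - 1) / elem_sym {1..n} x (tail_count s m r)"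
proof -
  define C where "C = configs n s m"
  define M where "M = tail_count s m r"
  define R where "R = (\<Sum>k=1..n. 1 / x k)"
  define pr where "pr \<eta> = {k \<in> {1..n}. r \<le> \<eta> k}" for \<eta> :: "nat \<Rightarrow> nat"
  define p where "p A = (\<Sum>\<eta> | \<eta> \<in> C \<and> pr \<eta> = A. pmf \<pi> \<eta>)" for A
  have fin: "finite C"
    by (simp add: C_def finite_configs)
  have M: "M < n"
    unfolding M_def by (rule tail_count_less[OF n assms(5)])
  have pr: "pr ` C \<subseteq> states n M"
    using superlevel_in_states by (auto simp: C_def pr_def M_def)
  have proj: "(\<Sum>\<eta>\<in>C. pmf \<pi> \<eta> * f (pr \<eta>)) = (\<Sum>A\<in>states n M. p A * f A)" for f
  proof -
    have "(\<Sum>\<eta>\<in>C. pmf \<pi> \<eta> * f (pr \<eta>)) =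
        (\<Sum>A\<in>states n M. \<Sum>\<eta> | \<eta> \<in> C \<and> pr \<eta> = A. pmf \<pi> \<eta> * f (pr \<eta>))"
      using fin finite_states pr by (rule sum.group[symmetric])
    also have "\<dots> = (\<Sum>A\<in>states n M. p A * f A)"
      unfolding p_def sum_distrib_right by (intro sum.cong) auto
    finally show ?thesis .
  qed
  have total: "(\<Sum>A\<in>states n M. p A) = 1"
    using proj[of "\<lambda>_. 1"] sum_pmf_eq_1[of C \<pi>] fin stat
    by (simp add: pushtasep_stationary_def C_def)
  have bal: "(\<Sum>(A, j)\<in>moves_into n M B. p A / x j) = p B * R" if B: "B \<in> states n M" for B
  proof -
    \<comment> \<open>The total rate from \<open>\<eta>\<close> into the fibre over \<open>B\<close>
      depends on \<open>\<eta>\<close> only through \<open>pr \<eta>\<close>; this lets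
      \<open>proj\<close> rewrite the flux in terms of \<open>p\<close>.\<close>
    have rates: "(\<Sum>\<zeta> | \<zeta> \<in> C \<and> pr \<zeta> = B. jump_rate n x \<eta> \<zeta>) =
        (\<Sum>j | j \<in> {1..n} \<and> push n (pr \<eta>) j = B. 1 / x j)" if \<eta>: "\<eta> \<in> C" for \<eta>
    proof -
      let ?J = "{j. j \<in> {1..n} \<and> pr (ring_bell n \<eta> j) = B}" and ?Z = "{\<zeta>. \<zeta> \<in> C \<and> pr \<zeta> = B}"
      have "(\<Sum>\<zeta>\<in>?Z. jump_rate n x \<eta> \<zeta>) = (\<Sum>\<zeta>\<in>?Z. \<Sum>j | j \<in> ?J \<and> ring_bell n \<eta> j = \<zeta>. 1 / x j)"
        unfolding jump_rate_def by (intro sum.cong) auto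
      also have "\<dots> = (\<Sum>j\<in>?J. 1 / x j)"
        using fin ring_bell_in_configs[OF n] \<eta> by (intro sum.group) (auto simp: C_def)
      also have "?J = {j. j \<in> {1..n} \<and> push n (pr \<eta>) j = B}"
        unfolding pr_def using superlevel_ring_bell[OF assms(5)] by auto
      finally show ?thesis .
    qed
    have "p B * R = (\<Sum>\<zeta> | \<zeta> \<in> C \<and> pr \<zeta> = B. \<Sum>\<eta>\<in>C. pmf \<pi> \<eta> * jump_rate n x \<eta> \<zeta>)"
      unfolding p_def R_def sum_distrib_right
      using stationary_full_balance[OF n stat] by (intro sum.cong) (auto simp: C_def)
    also have "\<dots> = (\<Sum>\<eta>\<in>C. pmf \<pi> \<eta> * (\<Sum>\<zeta> | \<zeta> \<in> C \<and> pr \<zeta> = B. jump_rate n x \<eta> \<zeta>))"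
      unfolding sum_distrib_left by (rule sum.swap)
    also have "\<dots> = (\<Sum>\<eta>\<in>C. pmf \<pi> \<eta> * (\<Sum>j | j \<in> {1..n} \<and> push n (pr \<eta>) j = B. 1 / x j))"
      using rates by (intro sum.cong) auto
    also have "\<dots> = (\<Sum>A\<in>states n M. p A * (\<Sum>j | j \<in> {1..n} \<and> push n A j = B. 1 / x j))"
      by (rule proj)
    also have "\<dots> = (\<Sum>(A, j)\<in>moves_into n M B. p A / x j)"
      unfolding moves_into_def sum_distrib_left
      by (subst sum.Sigma) (auto simp: finite_states)
    finally show ?thesis by simp
  qed
  have p: "p A = (\<Prod>i\<in>A. x i) / elem_sym {1..n} x M" if "A \<in> states n M" for A
    using single_species_stationary[OF M pos bal[unfolded R_def] total that] .
  have "1 \<in> {1..n}"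
    using M by simp
  then have "(\<Sum>\<eta> | \<eta> \<in> C \<and> r \<le> \<eta> 1. pmf \<pi> \<eta>) = (\<Sum>\<eta>\<in>C. pmf \<pi> \<eta> * of_bool (1 \<in> pr \<eta>))"
    using fin by (intro sum.mono_neutral_cong_left) (auto simp: pr_def)
  also have "\<dots> = (\<Sum>A\<in>states n M. p A * of_bool (1 \<in> A))"
    by (rule proj)
  also have "\<dots> = (\<Sum>A | A \<in> states n M \<and> 1 \<in> A. (\<Prod>i\<in>A. x i) / elem_sym {1..n} x M)"
    using finite_states p by (intro sum.mono_neutral_cong_right) auto
  also have "\<dots> = x 1 * elem_sym_int {2..n} x (int M - 1) / elem_sym {1..n} x M"
    unfolding sum_divide_distrib[symmetric] using M by (subst sum_with_containing_1) simp_all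
  finally show ?thesis
    by (simp add: C_def M_def)
qed

theorem proposition18:
  fixes n s j :: nat and m :: "nat \<Rightarrow> nat" and x :: "nat \<Rightarrow> real"
    and \<pi> :: "(nat \<Rightarrow> nat) pmf"
  assumes "n = (\<Sum>r=0..s. m r)"
    and "m 0 \<ge> 1"
    and "\<And>i. i \<in> {1..n} \<Longrightarrow> x i > 0"
    and "1 \<le> j" and "j \<le> s" and "m j \<ge> 1"
    and "pushtasep_stationary n s m x \<pi>"
  shows "measure_pmf.expectation \<pi> (occupied j 1) =
    x 1 * schur {2..n} x (replicate (tail_count s m (j + 1)) 2 @ replicate (m j - 1) 1)
      / (elem_sym {1..n} x (tail_count s m j) * elem_sym {1..n} x (tail_count s m (j + 1)))"
proof -
  define C where "C = configs n s m"
  define a where "a = tail_count s m j"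
  define b where "b = tail_count s m (j + 1)"
  let ?E = "elem_sym_int {2..n} x"
  have ab: "a = m j + b"
    using assms(5) by (simp add: a_def b_def tail_count_def sum.atLeast_Suc_atMost)
  have lt: "a < n" "b < n"
    unfolding a_def b_def using assms(1,2,4) tail_count_less by auto
  have N: "{1..n} = insert 1 {2..n}"
    using lt by auto
  have e: "elem_sym {1..n} x k = ?E (int k) + x 1 * ?E (int k - 1)" for k
  proof -
    have "elem_sym_int (insert 1 {2..n}) x (int k) = ?E (int k) + x 1 * ?E (int k - 1)"
      by (rule elem_sym_int_insert) auto
    then show ?thesis
      unfolding N[symmetric] elem_sym_int_of_nat .
  qed
  have pos: "0 < elem_sym {1..n} x a" "0 < elem_sym {1..n} x b"
    using lt assms(3) by (auto intro!: elem_sym_pos)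
  have fin: "finite C"
    by (simp add: C_def finite_configs)
  have level: "(\<Sum>\<eta>\<in>C. of_bool (r \<le> \<eta> 1) * pmf \<pi> \<eta>) = (\<Sum>\<eta> | \<eta> \<in> C \<and> r \<le> \<eta> 1. pmf \<pi> \<eta>)" for r
    using fin by (intro sum.mono_neutral_cong_right) auto
  have "measure_pmf.expectation \<pi> (occupied j 1) = (\<Sum>\<eta>\<in>C. occupied j 1 \<eta> * pmf \<pi> \<eta>)"
    using fin assms(7) by (intro integral_measure_pmf_real) (auto simp: C_def pushtasep_stationary_def)
  \<comment> \<open>Site 1 holds species \<open>j\<close> when its species is at least
    \<open>j\<close> but not at least \<open>j + 1\<close>.\<close>
  also have "\<dots> = (\<Sum>\<eta>\<in>C. of_bool (j \<le> \<eta> 1) * pmf \<pi> \<eta>) - (\<Sum>\<eta>\<in>C. of_bool (j + 1 \<le> \<eta> 1) * pmf \<pi> \<eta>)"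
    unfolding sum_subtractf[symmetric] by (intro sum.cong) (auto simp: occupied_def)
  finally have "measure_pmf.expectation \<pi> (occupied j 1) =
      x 1 * ?E (int a - 1) / elem_sym {1..n} x a - x 1 * ?E (int b - 1) / elem_sym {1..n} x b"
    unfolding level using prob_superlevel[OF assms(1,2,3,7), of j] prob_superlevel[OF assms(1,2,3,7), of "j + 1"]
      assms(4) by (simp add: C_def a_def b_def)
  also have "\<dots> = x 1 * (?E (int a - 1) * ?E (int b) - ?E (int a) * ?E (int b - 1))
      / (elem_sym {1..n} x a * elem_sym {1..n} x b)"
  proof -
    \<comment> \<open>After expanding by \<open>e\<close>, the two terms quadratic in
      \<open>x 1\<close> cancel.\<close>
    have "x 1 * ?E (int a - 1) * elem_sym {1..n} x b - x 1 * ?E (int b - 1) * elem_sym {1..n} x a =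
        x 1 * (?E (int a - 1) * ?E (int b) - ?E (int a) * ?E (int b - 1))"
      unfolding e by (simp add: algebra_simps)
    then show ?thesis
      using diff_frac_eq[of "elem_sym {1..n} x a" "elem_sym {1..n} x b"] pos by (metis less_irrefl)
  qed
  also have "?E (int a - 1) * ?E (int b) - ?E (int a) * ?E (int b - 1) =
      schur {2..n} x (replicate b 2 @ replicate (m j - 1) 1)"
  proof -
    \<comment> \<open>The first column has \<open>a - 1\<close> boxes; \<open>m j \<ge> 1\<close>
      makes the natural subtraction exact and puts \<open>b - 1 \<le> a - 1\<close> within the range
      of the determinant formula.\<close>
    have "int (b + (m j - 1)) = int a - 1"
      using assms(6) ab by simp
    then show ?thesis
      unfolding schur_two_column[OF finite_atLeastAtMost] using assms(6) ab
      by (simp only:) (subst column_sum_jacobi_trudi; simp)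
  qed
  finally show ?thesis
    by (simp add: a_def b_def)
qed

end
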